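(* Let $R$ be a commutative ring considered as a semigroup under multiplication, and let $i:I\hookrightarrow R$ be the inclusion of a proper ideal $I\subset R$, considered as a sub-semigroup inclusion in the category of semigroups and semigroup maps. Then the pullback of multiplication along the inclusion, $I\times_R(R\times R)$, is isomorphic to $(I\times R)\cup(R\times I)$ if and only if $I$ is a prime ideal of $R$.
   Context: $R\times R$ is the product semigroup, and multiplication $R\times R\to R$, $(x,y)\mapsto xy$, is a semigroup map since $R$ is commutative. $I\times_R(R\times R)$ denotes the pullback, in the category of semigroups and semigroup maps, of the multiplication map $R\times R\to R$ along $i:I\hookrightarrow R$. The union $(I\times R)\cup(R\times I)$ is taken inside $R\times R$. *)

theory Defs
  imports "HOL-Algebra.Ideal"
begin

text \<open>Semigroups are represented by the \<open>monoid\<close> record, whose field \<open>one\<close> is never used: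
  the library's \<open>hom\<close>, \<open>iso\<close> and \<open>\<cong>\<close> only refer to the fields \<open>carrier\<close> and \<open>mult\<close>,
  so they are exactly the semigroup maps and semigroup isomorphisms.\<close>

locale msemigroup =
  fixes S (structure)
  assumes m_closed: "\<lbrakk>x \<in> carrier S; y \<in> carrier S\<rbrakk> \<Longrightarrow> x \<otimes> y \<in> carrier S"
    and m_assoc: "\<lbrakk>x \<in> carrier S; y \<in> carrier S; z \<in> carrier S\<rbrakk>
      \<Longrightarrow> (x \<otimes> y) \<otimes> z = x \<otimes> (y \<otimes> z)"

definition sg_pullback ::
  "('a, 'm) monoid_scheme \<Rightarrow> ('b, 'n) monoid_scheme \<Rightarrow> ('a \<Rightarrow> 'c) \<Rightarrow> ('b \<Rightarrow> 'c) \<Rightarrow> ('a \<times> 'b) monoid"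
  where "sg_pullback A B f g =
    (A \<times>\<times> B)\<lparr>carrier := {(a, b). a \<in> carrier A \<and> b \<in> carrier B \<and> f a = g b}\<rparr>"

definition mult_map :: "('a, 'm) monoid_scheme \<Rightarrow> 'a \<times> 'a \<Rightarrow> 'a"
  where "mult_map S = (\<lambda>(x, y). x \<otimes>\<^bsub>S\<^esub> y)"

definition sub_sg :: "('a, 'm) monoid_scheme \<Rightarrow> 'a set \<Rightarrow> ('a, 'm) monoid_scheme"
  where "sub_sg S H = S\<lparr>carrier := H\<rparr>"

lemma sg_pullback_semigroup:
  assumes "msemigroup A" "msemigroup B" "msemigroup C" "f \<in> hom A C" "g \<in> hom B C"
  shows "msemigroup (sg_pullback A B f g)"
  using assms by (auto simp: msemigroup_def sg_pullback_def DirProd_def hom_def)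

lemma sg_pullback_cone:
  "fst \<in> hom (sg_pullback A B f g) A"
  "snd \<in> hom (sg_pullback A B f g) B"
  "p \<in> carrier (sg_pullback A B f g) \<Longrightarrow> f (fst p) = g (snd p)"
  by (auto simp: sg_pullback_def DirProd_def hom_def)

text \<open>Universal property. Maps out of a carrier are compared up to their values outside it,
  whence \<open>extensional\<close>.\<close>

lemma sg_pullback_universal:
  assumes Z: "msemigroup Z" and p: "p \<in> hom Z A" and q: "q \<in> hom Z B"
    and comm: "\<And>z. z \<in> carrier Z \<Longrightarrow> f (p z) = g (q z)"
  shows "\<exists>!h. h \<in> hom Z (sg_pullback A B f g) \<and> h \<in> extensional (carrier Z) \<and>
    (\<forall>z\<in>carrier Z. fst (h z) = p z \<and> snd (h z) = q z)"
proof (rule ex1I)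
  let ?h = "restrict (\<lambda>z. (p z, q z)) (carrier Z)"
  show "?h \<in> hom Z (sg_pullback A B f g) \<and> ?h \<in> extensional (carrier Z) \<and>
    (\<forall>z\<in>carrier Z. fst (?h z) = p z \<and> snd (?h z) = q z)"
    using assms by (auto simp: msemigroup_def sg_pullback_def DirProd_def hom_def)
  fix h
  assume "h \<in> hom Z (sg_pullback A B f g) \<and> h \<in> extensional (carrier Z) \<and>
    (\<forall>z\<in>carrier Z. fst (h z) = p z \<and> snd (h z) = q z)"
  then show "h = ?h"
    by (intro extensionalityI[of h "carrier Z" ?h]) (auto simp: prod_eq_iff)
qed

lemma (in cring) ring_semigroups:
  shows "msemigroup R" "msemigroup (R \<times>\<times> R)" "mult_map R \<in> hom (R \<times>\<times> R) R"
  by (auto simp: msemigroup_def DirProd_def hom_def mult_map_def m_assoc m_lcomm)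

lemma (in ideal) ideal_semigroups:
  shows "msemigroup (sub_sg R I)" "(\<lambda>x. x) \<in> hom (sub_sg R I) R"
    "msemigroup (sub_sg (R \<times>\<times> R) (I \<times> carrier R \<union> carrier R \<times> I))"
  using a_subset by (auto simp: msemigroup_def sub_sg_def DirProd_def hom_def
      intro: I_l_closed I_r_closed m_assoc)

end

theory Submission
  imports Defs
begin

text \<open>If \<open>I\<close> is prime, the second projection is the required isomorphism. For the converse,
  call \<open>w\<close> a join of \<open>q\<close> onto \<open>s\<close> away from \<open>t\<close> if \<open>s w = s\<close> and \<open>t w = t q\<close>; this notion is
  invariant under isomorphism. Let \<open>s\<close>, \<open>t\<close> be idempotents with \<open>s t = 0\<close>. If \<open>s\<close> and \<open>q\<close> both lie
  in \<open>I \<times> R\<close>, or both in \<open>R \<times> I\<close>, then \<open>s + (1 - s) q\<close> is such a join within the same ideal.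
  Among any \<open>s\<close>, \<open>t\<close>, \<open>q\<close> in \<open>(I \<times> R) \<union> (R \<times> I)\<close> two lie in the same piece, so \<open>q\<close> joins onto \<open>s\<close>,
  or \<open>q\<close> joins onto \<open>t\<close>, or \<open>t\<close> joins onto \<open>s\<close>. In the pullback take \<open>s = (1, 0)\<close>, \<open>t = (0, 1)\<close> and
  \<open>q = (x, y)\<close> with \<open>x y \<in> I\<close>: the joins are \<open>(1, y)\<close>, \<open>(x, 1)\<close> and \<open>(1, 1)\<close>, and they lie in
  the pullback only if \<open>y \<in> I\<close>, \<open>x \<in> I\<close> and \<open>1 \<in> I\<close>, respectively.\<close>

definition joins_onto :: "('a, 'm) monoid_scheme \<Rightarrow> 'a \<Rightarrow> 'a \<Rightarrow> 'a \<Rightarrow> bool"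
  where "joins_onto S s t q \<longleftrightarrow>
    (\<exists>w\<in>carrier S. s \<otimes>\<^bsub>S\<^esub> w = s \<and> t \<otimes>\<^bsub>S\<^esub> w = t \<otimes>\<^bsub>S\<^esub> q)"

text \<open>Surjectivity of \<open>h\<close> lifts the witness from \<open>T\<close> to
  \<open>S\<close>, and injectivity reflects the two defining equations.\<close>

lemma iso_joins_onto:
  assumes S: "msemigroup S" and h: "h \<in> iso S T"
    and mem: "s \<in> carrier S" "t \<in> carrier S" "q \<in> carrier S"
    and join: "joins_onto T (h s) (h t) (h q)"
  shows "joins_onto S s t q"
proof -
  have inj: "inj_on h (carrier S)" and surj: "h ` carrier S = carrier T"
    and hom: "\<And>x y. \<lbrakk>x \<in> carrier S; y \<in> carrier S\<rbrakk> \<Longrightarrow> h (x \<otimes>\<^bsub>S\<^esub> y) = h x \<otimes>\<^bsub>T\<^esub> h y"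
    using h by (auto simp: iso_def hom_def bij_betw_def)
  obtain v where "v \<in> h ` carrier S" "h s \<otimes>\<^bsub>T\<^esub> v = h s" "h t \<otimes>\<^bsub>T\<^esub> v = h t \<otimes>\<^bsub>T\<^esub> h q"
    using join unfolding joins_onto_def surj by blast
  then obtain w where w: "w \<in> carrier S" "h s \<otimes>\<^bsub>T\<^esub> h w = h s" "h t \<otimes>\<^bsub>T\<^esub> h w = h t \<otimes>\<^bsub>T\<^esub> h q"
    by blast
  have "s \<otimes>\<^bsub>S\<^esub> w = s" "t \<otimes>\<^bsub>S\<^esub> w = t \<otimes>\<^bsub>S\<^esub> q"
    using w mem by (simp_all add: hom msemigroup.m_closed[OF S] flip: inj_on_eq_iff[OF inj])
  with w(1) show ?thesis
    unfolding joins_onto_def by blast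
qed

context cring
begin

lemma idempotent_mult_join:
  assumes "s \<in> carrier R" "q \<in> carrier R" "s \<otimes> s = s"
  shows "s \<otimes> (s \<oplus> (\<one> \<ominus> s) \<otimes> q) = s"
proof -
  \<comment> \<open>Collecting \<open>s \<otimes> s\<close> leaves an identity valid in every
    commutative ring; idempotency enters only afterwards.\<close>
  have "s \<otimes> (s \<oplus> (\<one> \<ominus> s) \<otimes> q) = s \<otimes> s \<oplus> (s \<ominus> s \<otimes> s) \<otimes> q"
    using assms(1,2) by algebra
  also have "\<dots> = s"
    unfolding assms(3) using assms(1,2) by algebra
  finally show ?thesis .
qed

lemma orthogonal_mult_join:
  assumes "s \<in> carrier R" "t \<in> carrier R" "q \<in> carrier R" "s \<otimes> t = \<zero>"
  shows "t \<otimes> (s \<oplus> (\<one> \<ominus> s) \<otimes> q) = t \<otimes> q"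
proof -
  have "t \<otimes> (s \<oplus> (\<one> \<ominus> s) \<otimes> q) = s \<otimes> t \<oplus> t \<otimes> q \<ominus> s \<otimes> t \<otimes> q"
    using assms(1-3) by algebra
  also have "\<dots> = t \<otimes> q"
    unfolding assms(4) using assms(1-3) by algebra
  finally show ?thesis .
qed

end

context ideal
begin

lemma join_closed:
  assumes "s \<in> I" "q \<in> I"
  shows "s \<oplus> (\<one> \<ominus> s) \<otimes> q \<in> I"
  using assms a_subset by (auto intro!: a_closed I_l_closed)

abbreviation cross :: "('a \<times> 'a) monoid"
  where "cross \<equiv> sub_sg (R \<times>\<times> R) (I \<times> carrier R \<union> carrier R \<times> I)"

abbreviation mult_pullback :: "('a \<times> 'a \<times> 'a) monoid"
  where "mult_pullback \<equiv> sg_pullback (sub_sg R I) (R \<times>\<times> R) (\<lambda>x. x) (mult_map R)"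

lemma carrier_mult_pullback:
  "carrier mult_pullback = {(x \<otimes> y, x, y) |x y. x \<in> carrier R \<and> y \<in> carrier R \<and> x \<otimes> y \<in> I}"
  by (auto simp: sg_pullback_def sub_sg_def DirProd_def mult_map_def)

lemma mult_mult_pullback:
  "(a, x, y) \<otimes>\<^bsub>mult_pullback\<^esub> (b, x', y') = (a \<otimes> b, x \<otimes> x', y \<otimes> y')"
  by (simp add: sg_pullback_def sub_sg_def DirProd_def)

text \<open>The join is formed in each coordinate. Where \<open>A\<close> demands membership in
  \<open>I\<close>, both \<open>s\<close> and \<open>q\<close> supply it, so the join stays in
  \<open>A\<close>; \<open>t\<close> may lie in the other piece.\<close>

lemma cross_joins_onto:
  assumes R: "cring R"
    and A: "A = I \<times> carrier R \<or> A = carrier R \<times> I"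
    and mem: "s \<in> A" "q \<in> A" and t: "t \<in> carrier cross"
    and idem: "s \<otimes>\<^bsub>cross\<^esub> s = s" and orth: "s \<otimes>\<^bsub>cross\<^esub> t = (\<zero>, \<zero>)"
  shows "joins_onto cross s t q"
proof -
  interpret R: cring R by (rule R)
  obtain s1 s2 where s: "s = (s1, s2)" by (cases s)
  obtain q1 q2 where q: "q = (q1, q2)" by (cases q)
  obtain t1 t2 where tt: "t = (t1, t2)" by (cases t)
  have cs: "s1 \<in> carrier R" "s2 \<in> carrier R" "q1 \<in> carrier R" "q2 \<in> carrier R"
    "t1 \<in> carrier R" "t2 \<in> carrier R"
    using A mem t a_subset by (auto simp: s q tt sub_sg_def)
  have eqs: "s1 \<otimes> s1 = s1" "s2 \<otimes> s2 = s2" "s1 \<otimes> t1 = \<zero>" "s2 \<otimes> t2 = \<zero>"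
    using idem orth by (auto simp: s tt sub_sg_def DirProd_def)
  let ?w = "(s1 \<oplus> (\<one> \<ominus> s1) \<otimes> q1, s2 \<oplus> (\<one> \<ominus> s2) \<otimes> q2)"
  have "?w \<in> carrier cross"
    using A mem cs by (auto simp: s q sub_sg_def join_closed)
  moreover have "s \<otimes>\<^bsub>cross\<^esub> ?w = s" "t \<otimes>\<^bsub>cross\<^esub> ?w = t \<otimes>\<^bsub>cross\<^esub> q"
    using cs eqs
    by (simp_all add: s q tt sub_sg_def DirProd_def R.idempotent_mult_join R.orthogonal_mult_join)
  ultimately show ?thesis
    unfolding joins_onto_def by blast
qed

lemma cross_joins_onto_cases:
  assumes R: "cring R"
    and mem: "s \<in> carrier cross" "t \<in> carrier cross" "q \<in> carrier cross"
    and idem: "s \<otimes>\<^bsub>cross\<^esub> s = s" "t \<otimes>\<^bsub>cross\<^esub> t = t"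
    and orth: "s \<otimes>\<^bsub>cross\<^esub> t = (\<zero>, \<zero>)" "t \<otimes>\<^bsub>cross\<^esub> s = (\<zero>, \<zero>)"
  shows "joins_onto cross s t q \<or> joins_onto cross t s q \<or> joins_onto cross s t t"
proof -
  let ?A = "I \<times> carrier R" and ?B = "carrier R \<times> I"
  have "s \<in> ?A \<union> ?B" "t \<in> ?A \<union> ?B" "q \<in> ?A \<union> ?B"
    using mem by (simp_all add: sub_sg_def)
  \<comment> \<open>Pigeonhole: three elements, two pieces.\<close>
  then have "\<exists>A. (A = ?A \<or> A = ?B) \<and> (s \<in> A \<and> q \<in> A \<or> t \<in> A \<and> q \<in> A \<or> s \<in> A \<and> t \<in> A)"
    by (elim UnE) blast+
  then obtain A where "A = ?A \<or> A = ?B" "s \<in> A \<and> q \<in> A \<or> t \<in> A \<and> q \<in> A \<or> s \<in> A \<and> t \<in> A"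
    by (elim exE conjE)
  then show ?thesis
    using cross_joins_onto[OF R] mem idem orth by metis
qed

text \<open>Zero is absorbing on both sides: multiplying it by a preimage of
  \<open>(\<zero>, \<zero>)\<close> gives zero again, while the image of that product is
  \<open>(\<zero>, \<zero>)\<close>. This carries orthogonality across \<open>h\<close>.\<close>

lemma iso_zero:
  assumes h: "h \<in> iso mult_pullback cross"
  shows "h (\<zero>, \<zero>, \<zero>) = (\<zero>, \<zero>)"
proof -
  have Z: "(\<zero>, \<zero>, \<zero>) \<in> carrier mult_pullback"
    by (force simp: carrier_mult_pullback)
  have "(\<zero>, \<zero>) \<in> carrier cross"
    by (simp add: sub_sg_def)
  then have "(\<zero>, \<zero>) \<in> h ` carrier mult_pullback"
    using h by (simp add: iso_def bij_betw_def)
  then obtain p where p: "p \<in> carrier mult_pullback" "h p = (\<zero>, \<zero>)"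
    by (metis imageE)
  have "(\<zero>, \<zero>, \<zero>) \<otimes>\<^bsub>mult_pullback\<^esub> p = (\<zero>, \<zero>, \<zero>)"
    using p(1) a_subset by (auto simp: carrier_mult_pullback mult_mult_pullback)
  then have "h (\<zero>, \<zero>, \<zero>) = h (\<zero>, \<zero>, \<zero>) \<otimes>\<^bsub>cross\<^esub> (\<zero>, \<zero>)"
    using hom_mult[OF iso_imp_homomorphism[OF h] Z p(1)] p(2) by simp
  moreover have "h (\<zero>, \<zero>, \<zero>) \<in> carrier cross"
    using h Z by (auto simp: iso_def hom_def)
  ultimately show ?thesis
    using a_subset by (auto simp: sub_sg_def DirProd_def)
qed

lemma iso_imp_prime:
  assumes R: "cring R" and h: "h \<in> iso mult_pullback cross" and proper: "\<one> \<notin> I"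
    and x: "x \<in> carrier R" and y: "y \<in> carrier R" and xy: "x \<otimes> y \<in> I"
  shows "x \<in> I \<or> y \<in> I"
proof -
  interpret R: cring R by (rule R)
  let ?P = mult_pullback
  let ?s = "(\<zero>, \<one>, \<zero>)" and ?t = "(\<zero>, \<zero>, \<one>)" and ?q = "(x \<otimes> y, x, y)"
  have mem: "?s \<in> carrier ?P" "?t \<in> carrier ?P" "?q \<in> carrier ?P"
    using x y xy by (auto simp: carrier_mult_pullback)
  have sg: "msemigroup ?P"
    using R.ring_semigroups ideal_semigroups by (intro sg_pullback_semigroup)
  have hmem: "h p \<in> carrier cross" if "p \<in> carrier ?P" for p
    using h that by (auto simp: iso_def hom_def)
  have hmult: "h p \<otimes>\<^bsub>cross\<^esub> h p' = h (p \<otimes>\<^bsub>?P\<^esub> p')"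
    if "p \<in> carrier ?P" "p' \<in> carrier ?P" for p p'
    using hom_mult[OF iso_imp_homomorphism[OF h] that] by simp
  have "joins_onto cross (h ?s) (h ?t) (h ?q) \<or> joins_onto cross (h ?t) (h ?s) (h ?q)
      \<or> joins_onto cross (h ?s) (h ?t) (h ?t)"
    by (rule cross_joins_onto_cases[OF R])
      (use mem in \<open>simp_all add: hmem hmult mult_mult_pullback iso_zero[OF h]\<close>)
  then have "joins_onto ?P ?s ?t ?q \<or> joins_onto ?P ?t ?s ?q \<or> joins_onto ?P ?s ?t ?t"
    using iso_joins_onto[OF sg h] mem by blast
  \<comment> \<open>Multiplying by \<open>?s\<close> and \<open>?t\<close> reads off the two factors
    of the witness, whose product must lie in \<open>I\<close>.\<close>
  then show ?thesis
    using x y proper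
    by (auto simp: joins_onto_def carrier_mult_pullback mult_mult_pullback)
qed

end

text \<open>The first component is the product of the other two, so \<open>snd\<close> is injective.
  Its image is the set of pairs with product in \<open>I\<close>, which lies inside
  \<open>cross\<close> by primality and contains it by absorption.\<close>

lemma (in primeideal) snd_iso: "snd \<in> iso mult_pullback cross"
proof -
  have cross: "carrier cross = {(x, y). x \<in> carrier R \<and> y \<in> carrier R \<and> x \<otimes> y \<in> I}"
    using a_subset I_prime by (auto simp: sub_sg_def intro: I_l_closed I_r_closed)
  have "inj_on snd (carrier mult_pullback)"
    by (auto simp: inj_on_def carrier_mult_pullback)
  moreover have image: "snd ` carrier mult_pullback = carrier cross"
    unfolding cross carrier_mult_pullback by force
  moreover have "snd \<in> hom mult_pullback cross"
  proof (rule homI)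
    show "snd p \<in> carrier cross" if "p \<in> carrier mult_pullback" for p
      unfolding image[symmetric] using that by (rule imageI)
  qed (simp add: sg_pullback_def sub_sg_def DirProd_def split: prod.splits)
  ultimately show ?thesis
    by (simp add: iso_def bij_betw_def)
qed

theorem proposition0p1p0:
  fixes R :: "('a, 'm) ring_scheme" and I :: "'a set"
  assumes "cring R"
    and "ideal I R"
    and "I \<subset> carrier R"
  shows "sg_pullback (sub_sg R I) (R \<times>\<times> R) (\<lambda>x. x) (mult_map R)
      \<cong> sub_sg (R \<times>\<times> R) (I \<times> carrier R \<union> carrier R \<times> I)
    \<longleftrightarrow> primeideal I R"
proof -
  interpret ideal I R by (rule assms(2))
  have proper: "\<one>\<^bsub>R\<^esub> \<notin> I"
    using assms(3) one_imp_carrier by blast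
  show ?thesis
  proof
    assume "mult_pullback \<cong> cross"
    then obtain h where "h \<in> iso mult_pullback cross"
      by (auto simp: is_iso_def)
    with assms proper show "primeideal I R"
      by (intro primeidealI) (auto dest: iso_imp_prime)
  next
    assume "primeideal I R"
    then show "mult_pullback \<cong> cross"
      by (auto simp: is_iso_def dest: primeideal.snd_iso)
  qed
qed

end
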